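(* Let $R$ be a nonzero associative ring with identity, let $n\geq 1$, and let $T_n(R)$ be the ring of $n\times n$ upper triangular matrices over $R$. Let $I$ be an ideal of $T_n(R)$, written in the form $$I=\begin{pmatrix} J_{11} & J_{12} & \cdots & J_{1n}\\ 0 & J_{22} & \cdots & J_{2n}\\ \vdots & & \ddots & \vdots\\ 0 & 0 & \cdots & J_{nn}\end{pmatrix}.$$ Then $I$ is a $z^{\circ}$-ideal of $T_n(R)$ if and only if each $J_{ii}$ ($1\leq i\leq n$) is a $z^{\circ}$-ideal of $R$ and $J_{ij}=R$ for all $j>i$.
   Context: "Ideal" means two-sided ideal. For an element $a$ of a ring $R$, $P_a$ is the intersection of all minimal prime ideals of $R$ containing $a$ (an empty intersection is the whole ring). An ideal $I$ of a ring $R$ is a $z^{\circ}$-ideal if $P_a\subseteq I$ for every $a\in I$. Every ideal of $T_n(R)$ is the set of upper triangular matrices $[a_{ij}]$ with $a_{ij}\in J_{ij}$ for all $i\le j$, for uniquely determined ideals $J_{ij}$ ($1\le i\le j\le n$) of $R$ satisfying $J_{i,k}\subseteq J_{i,k+1}$ and $J_{i+1,k}\subseteq J_{i,k}$ whenever these are defined. *)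

theory Defs
  imports "HOL-Algebra.Ideal_Product" "Jordan_Normal_Form.Matrix"
begin

text \<open>
  The locale \<^term>\<open>primeideal\<close> of HOL-Algebra is restricted to commutative rings.  For an arbitrary
  ring, a proper two-sided ideal \<open>P\<close> is prime if \<open>A B \<subseteq> P\<close> implies \<open>A \<subseteq> P\<close> or \<open>B \<subseteq> P\<close> for all
  two-sided ideals \<open>A\<close> and \<open>B\<close>.
\<close>

definition nc_prime_ideal :: "('a, 'b) ring_scheme \<Rightarrow> 'a set \<Rightarrow> bool" where
  "nc_prime_ideal R P \<longleftrightarrow>
     ideal P R \<and> P \<noteq> carrier R \<and>
     (\<forall>A B. ideal A R \<and> ideal B R \<and> ideal_prod R A B \<subseteq> P \<longrightarrow> A \<subseteq> P \<or> B \<subseteq> P)"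

definition minimal_prime_ideal :: "('a, 'b) ring_scheme \<Rightarrow> 'a set \<Rightarrow> bool" where
  "minimal_prime_ideal R P \<longleftrightarrow>
     nc_prime_ideal R P \<and> (\<forall>Q. nc_prime_ideal R Q \<and> Q \<subseteq> P \<longrightarrow> Q = P)"

text \<open>
  The ideal \<open>P\<^sub>a\<close>.  The minimal primes are minimal among all primes of \<open>R\<close>, not merely among those
  containing \<open>a\<close>.  Intersecting with the carrier makes the empty intersection the whole ring.
\<close>

definition min_prime_meet :: "('a, 'b) ring_scheme \<Rightarrow> 'a \<Rightarrow> 'a set" where
  "min_prime_meet R a = carrier R \<inter> \<Inter> {P. minimal_prime_ideal R P \<and> a \<in> P}"

definition z_circ_ideal :: "('a, 'b) ring_scheme \<Rightarrow> 'a set \<Rightarrow> bool" where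
  "z_circ_ideal R I \<longleftrightarrow> ideal I R \<and> (\<forall>a\<in>I. min_prime_meet R a \<subseteq> I)"

text \<open>
  The ring \<open>T\<^sub>n(R)\<close>.  Matrix entries are indexed from \<open>0\<close>, and all operations are those of \<open>R\<close>; the
  overloaded matrix operations are not used because they belong to the type-class structure on \<open>'a\<close>.
\<close>

definition upper_tri_carrier :: "('a, 'b) ring_scheme \<Rightarrow> nat \<Rightarrow> 'a mat set" where
  "upper_tri_carrier R n =
     {A \<in> carrier_mat n n.
        (\<forall>i<n. \<forall>j<n. A $$ (i, j) \<in> carrier R) \<and>
        (\<forall>i<n. \<forall>j<i. A $$ (i, j) = \<zero>\<^bsub>R\<^esub>)}"

definition upper_tri_ring :: "('a, 'b) ring_scheme \<Rightarrow> nat \<Rightarrow> 'a mat ring" where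
  "upper_tri_ring R n =
     \<lparr> carrier = upper_tri_carrier R n,
       monoid.mult = (\<lambda>A B. mat n n (\<lambda>(i, j). \<Oplus>\<^bsub>R\<^esub>k\<in>{..<n}. A $$ (i, k) \<otimes>\<^bsub>R\<^esub> B $$ (k, j))),
       one = mat n n (\<lambda>(i, j). if i = j then \<one>\<^bsub>R\<^esub> else \<zero>\<^bsub>R\<^esub>),
       zero = mat n n (\<lambda>(i, j). \<zero>\<^bsub>R\<^esub>),
       add = (\<lambda>A B. mat n n (\<lambda>(i, j). A $$ (i, j) \<oplus>\<^bsub>R\<^esub> B $$ (i, j))) \<rparr>"

text \<open>
  The set of upper triangular matrices whose \<open>(i, j)\<close> entry lies in \<open>J i j\<close> for all \<open>i \<le> j\<close>.
\<close>

definition upper_tri_entries :: "('a, 'b) ring_scheme \<Rightarrow> nat \<Rightarrow> (nat \<Rightarrow> nat \<Rightarrow> 'a set) \<Rightarrow> 'a mat set" where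
  "upper_tri_entries R n J =
     {A \<in> upper_tri_carrier R n. \<forall>i<n. \<forall>j<n. i \<le> j \<longrightarrow> A $$ (i, j) \<in> J i j}"

text \<open>
  The locale \<^term>\<open>ideal\<close> presupposes that the ambient structure is a ring, so this lemma is what
  keeps the predicate \<open>ideal I (upper_tri_ring R n)\<close> from being vacuous.
\<close>

lemma upper_tri_ring_is_ring:
  fixes R (structure)
  assumes "ring R"
  shows "ring (upper_tri_ring R n)"
proof -
  interpret ring R by fact
  let ?T = "upper_tri_ring R n"
  have carr: "\<And>A i j. A \<in> carrier ?T \<Longrightarrow> i < n \<Longrightarrow> j < n \<Longrightarrow> A $$ (i, j) \<in> carrier R"
    and low: "\<And>A i j. A \<in> carrier ?T \<Longrightarrow> i < n \<Longrightarrow> j < i \<Longrightarrow> A $$ (i, j) = \<zero>"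
    and dim: "\<And>A. A \<in> carrier ?T \<Longrightarrow> dim_row A = n \<and> dim_col A = n"
    by (auto simp: upper_tri_ring_def upper_tri_carrier_def)
  have add: "\<And>A B. A \<oplus>\<^bsub>?T\<^esub> B = mat n n (\<lambda>(i, j). A $$ (i, j) \<oplus> B $$ (i, j))"
    and mult: "\<And>A B. A \<otimes>\<^bsub>?T\<^esub> B = mat n n (\<lambda>(i, j). \<Oplus>k\<in>{..<n}. A $$ (i, k) \<otimes> B $$ (k, j))"
    and zero: "\<zero>\<^bsub>?T\<^esub> = mat n n (\<lambda>(i, j). \<zero>)"
    and one: "\<one>\<^bsub>?T\<^esub> = mat n n (\<lambda>(i, j). if i = j then \<one> else \<zero>)"
    by (simp_all add: upper_tri_ring_def)
  have add_idx: "\<And>A B i j. i < n \<Longrightarrow> j < n \<Longrightarrow> (A \<oplus>\<^bsub>?T\<^esub> B) $$ (i, j) = A $$ (i, j) \<oplus> B $$ (i, j)"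
    by (simp add: add)
  have mem: "\<And>f. (\<And>i j. i < n \<Longrightarrow> j < n \<Longrightarrow> f (i, j) \<in> carrier R) \<Longrightarrow>
      (\<And>i j. i < n \<Longrightarrow> j < i \<Longrightarrow> f (i, j) = \<zero>) \<Longrightarrow> mat n n f \<in> carrier ?T"
    by (auto simp: upper_tri_ring_def upper_tri_carrier_def)
  have mult_carr: "A \<otimes>\<^bsub>?T\<^esub> B \<in> carrier ?T" if A: "A \<in> carrier ?T" and B: "B \<in> carrier ?T" for A B
  proof -
    have "(\<Oplus>k\<in>{..<n}. A $$ (i, k) \<otimes> B $$ (k, j)) = \<zero>" if "i < n" "j < i" for i j
    proof -
      have "A $$ (i, k) \<otimes> B $$ (k, j) = \<zero>" if "k < n" for k
        using \<open>i < n\<close> \<open>j < i\<close> that low[OF A, of i k] low[OF B, of k j] carr[OF A, of i k]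
          carr[OF B, of k j]
        by (cases "k < i") auto
      then have "(\<Oplus>k\<in>{..<n}. A $$ (i, k) \<otimes> B $$ (k, j)) = (\<Oplus>k\<in>{..<n}. \<zero>)"
        by (intro finsum_cong') auto
      then show ?thesis by simp
    qed
    then show ?thesis
      unfolding mult using carr[OF A] carr[OF B] by (intro mem) (auto intro!: finsum_closed)
  qed
  have ab: "abelian_group ?T"
  proof (rule abelian_groupI)
    fix A assume A: "A \<in> carrier ?T"
    show "\<exists>B\<in>carrier ?T. B \<oplus>\<^bsub>?T\<^esub> A = \<zero>\<^bsub>?T\<^esub>"
      using carr[OF A] low[OF A] unfolding add zero
      by (intro bexI[of _ "mat n n (\<lambda>(i, j). \<ominus> (A $$ (i, j)))"] mem) (auto simp: l_neg)
  qed (auto simp: add zero carr low dim add.m_ac intro!: mem eq_matI)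
  have delta_l: "(\<Oplus>k\<in>{..<n}. \<one>\<^bsub>?T\<^esub> $$ (i, k) \<otimes> f k) = f i"
    if i: "i < n" and f: "\<And>k. k < n \<Longrightarrow> f k \<in> carrier R" for i f
  proof -
    have "(\<Oplus>k\<in>{..<n}. \<one>\<^bsub>?T\<^esub> $$ (i, k) \<otimes> f k) = (\<Oplus>k\<in>{..<n}. if i = k then f k else \<zero>)"
      using i f unfolding one by (intro finsum_cong') auto
    also have "\<dots> = f i" using i f by (intro add.finprod_singleton) auto
    finally show ?thesis .
  qed
  have delta_r: "(\<Oplus>k\<in>{..<n}. f k \<otimes> \<one>\<^bsub>?T\<^esub> $$ (k, i)) = f i"
    if i: "i < n" and f: "\<And>k. k < n \<Longrightarrow> f k \<in> carrier R" for i f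
  proof -
    have "(\<Oplus>k\<in>{..<n}. f k \<otimes> \<one>\<^bsub>?T\<^esub> $$ (k, i)) = (\<Oplus>k\<in>{..<n}. if i = k then f k else \<zero>)"
      using i f unfolding one by (intro finsum_cong') auto
    also have "\<dots> = f i" using i f by (intro add.finprod_singleton) auto
    finally show ?thesis .
  qed
  have swap: "(\<Oplus>k\<in>S. \<Oplus>l\<in>U. f k l) = (\<Oplus>l\<in>U. \<Oplus>k\<in>S. f k l)"
    if "finite S" "finite U" "\<And>k l. k \<in> S \<Longrightarrow> l \<in> U \<Longrightarrow> f k l \<in> carrier R" for S U :: "nat set" and f
    using that
  proof (induction S rule: finite_induct)
    case (insert x S)
    have "(\<Oplus>l\<in>U. \<Oplus>k\<in>insert x S. f k l) = (\<Oplus>l\<in>U. f x l \<oplus> (\<Oplus>k\<in>S. f k l))"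
      using insert by (intro finsum_cong' finsum_insert) (auto intro!: finsum_closed)
    also have "\<dots> = (\<Oplus>l\<in>U. f x l) \<oplus> (\<Oplus>l\<in>U. \<Oplus>k\<in>S. f k l)"
      using insert by (intro finsum_addf) (auto intro!: finsum_closed)
    finally show ?case
      using insert by (simp add: Pi_def)
  qed simp
  have monoid: "monoid ?T"
  proof (rule monoidI)
    show "\<one>\<^bsub>?T\<^esub> \<in> carrier ?T" unfolding one by (intro mem) auto
  next
    fix A assume A: "A \<in> carrier ?T"
    show "\<one>\<^bsub>?T\<^esub> \<otimes>\<^bsub>?T\<^esub> A = A" "A \<otimes>\<^bsub>?T\<^esub> \<one>\<^bsub>?T\<^esub> = A"
      by (auto intro!: eq_matI simp: mult delta_l[where f = "\<lambda>k. A $$ (k, _)"]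
            delta_r[where f = "\<lambda>k. A $$ (_, k)"] carr[OF A] dim[OF A])
  next
    fix A B C assume A: "A \<in> carrier ?T" and B: "B \<in> carrier ?T" and C: "C \<in> carrier ?T"
    have "(A \<otimes>\<^bsub>?T\<^esub> B \<otimes>\<^bsub>?T\<^esub> C) $$ (i, j) = (A \<otimes>\<^bsub>?T\<^esub> (B \<otimes>\<^bsub>?T\<^esub> C)) $$ (i, j)" (is "?L = ?R")
      if ij: "i < n" "j < n" for i j
    proof -
      have "?L = (\<Oplus>k\<in>{..<n}. (\<Oplus>l\<in>{..<n}. A $$ (i, l) \<otimes> B $$ (l, k)) \<otimes> C $$ (k, j))"
        using ij carr[OF A] carr[OF B] carr[OF C] unfolding mult
        by (simp, intro finsum_cong') (auto intro!: finsum_closed)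
      also have "\<dots> = (\<Oplus>k\<in>{..<n}. \<Oplus>l\<in>{..<n}. A $$ (i, l) \<otimes> B $$ (l, k) \<otimes> C $$ (k, j))"
        using ij carr[OF A] carr[OF B] carr[OF C]
        by (intro finsum_cong' finsum_ldistr) (auto intro!: finsum_closed)
      also have "\<dots> = (\<Oplus>l\<in>{..<n}. \<Oplus>k\<in>{..<n}. A $$ (i, l) \<otimes> B $$ (l, k) \<otimes> C $$ (k, j))"
        using ij carr[OF A] carr[OF B] carr[OF C] by (intro swap) auto
      also have "\<dots> = (\<Oplus>l\<in>{..<n}. \<Oplus>k\<in>{..<n}. A $$ (i, l) \<otimes> (B $$ (l, k) \<otimes> C $$ (k, j)))"
        using ij carr[OF A] carr[OF B] carr[OF C]
        by (intro finsum_cong') (auto intro!: finsum_closed simp: m_assoc)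
      also have "\<dots> = (\<Oplus>l\<in>{..<n}. A $$ (i, l) \<otimes> (\<Oplus>k\<in>{..<n}. B $$ (l, k) \<otimes> C $$ (k, j)))"
        using ij carr[OF A] carr[OF B] carr[OF C]
        by (intro finsum_cong' finsum_rdistr[symmetric]) (auto intro!: finsum_closed)
      also have "\<dots> = ?R"
        using ij carr[OF A] carr[OF B] carr[OF C] unfolding mult
        by (simp, intro finsum_cong') (auto intro!: finsum_closed)
      finally show ?thesis .
    qed
    then show "A \<otimes>\<^bsub>?T\<^esub> B \<otimes>\<^bsub>?T\<^esub> C = A \<otimes>\<^bsub>?T\<^esub> (B \<otimes>\<^bsub>?T\<^esub> C)"
      by (intro eq_matI) (auto simp: mult)
  qed (rule mult_carr)
  show ?thesis
  proof (rule ringI[OF ab monoid])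
    fix A B C assume A: "A \<in> carrier ?T" and B: "B \<in> carrier ?T" and C: "C \<in> carrier ?T"
    have "((A \<oplus>\<^bsub>?T\<^esub> B) \<otimes>\<^bsub>?T\<^esub> C) $$ (i, j) = (A \<otimes>\<^bsub>?T\<^esub> C \<oplus>\<^bsub>?T\<^esub> B \<otimes>\<^bsub>?T\<^esub> C) $$ (i, j)"
      "(C \<otimes>\<^bsub>?T\<^esub> (A \<oplus>\<^bsub>?T\<^esub> B)) $$ (i, j) = (C \<otimes>\<^bsub>?T\<^esub> A \<oplus>\<^bsub>?T\<^esub> C \<otimes>\<^bsub>?T\<^esub> B) $$ (i, j)"
      if ij: "i < n" "j < n" for i j
    proof -
      have "(\<Oplus>k\<in>{..<n}. (A \<oplus>\<^bsub>?T\<^esub> B) $$ (i, k) \<otimes> C $$ (k, j)) =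
            (\<Oplus>k\<in>{..<n}. A $$ (i, k) \<otimes> C $$ (k, j) \<oplus> B $$ (i, k) \<otimes> C $$ (k, j))"
        using ij carr[OF A] carr[OF B] carr[OF C] unfolding add
        by (intro finsum_cong') (auto simp: l_distr)
      also have "\<dots> = (\<Oplus>k\<in>{..<n}. A $$ (i, k) \<otimes> C $$ (k, j)) \<oplus> (\<Oplus>k\<in>{..<n}. B $$ (i, k) \<otimes> C $$ (k, j))"
        using ij carr[OF A] carr[OF B] carr[OF C] by (intro finsum_addf) auto
      finally show "((A \<oplus>\<^bsub>?T\<^esub> B) \<otimes>\<^bsub>?T\<^esub> C) $$ (i, j) = (A \<otimes>\<^bsub>?T\<^esub> C \<oplus>\<^bsub>?T\<^esub> B \<otimes>\<^bsub>?T\<^esub> C) $$ (i, j)"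
        using ij by (simp add: mult add_idx)
      have "(\<Oplus>k\<in>{..<n}. C $$ (i, k) \<otimes> (A \<oplus>\<^bsub>?T\<^esub> B) $$ (k, j)) =
            (\<Oplus>k\<in>{..<n}. C $$ (i, k) \<otimes> A $$ (k, j) \<oplus> C $$ (i, k) \<otimes> B $$ (k, j))"
        using ij carr[OF A] carr[OF B] carr[OF C] unfolding add
        by (intro finsum_cong') (auto simp: r_distr)
      also have "\<dots> = (\<Oplus>k\<in>{..<n}. C $$ (i, k) \<otimes> A $$ (k, j)) \<oplus> (\<Oplus>k\<in>{..<n}. C $$ (i, k) \<otimes> B $$ (k, j))"
        using ij carr[OF A] carr[OF B] carr[OF C] by (intro finsum_addf) auto
      finally show "(C \<otimes>\<^bsub>?T\<^esub> (A \<oplus>\<^bsub>?T\<^esub> B)) $$ (i, j) = (C \<otimes>\<^bsub>?T\<^esub> A \<oplus>\<^bsub>?T\<^esub> C \<otimes>\<^bsub>?T\<^esub> B) $$ (i, j)"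
        using ij by (simp add: mult add_idx)
    qed
    then show "(A \<oplus>\<^bsub>?T\<^esub> B) \<otimes>\<^bsub>?T\<^esub> C = A \<otimes>\<^bsub>?T\<^esub> C \<oplus>\<^bsub>?T\<^esub> B \<otimes>\<^bsub>?T\<^esub> C"
      "C \<otimes>\<^bsub>?T\<^esub> (A \<oplus>\<^bsub>?T\<^esub> B) = C \<otimes>\<^bsub>?T\<^esub> A \<oplus>\<^bsub>?T\<^esub> C \<otimes>\<^bsub>?T\<^esub> B"
      by (auto intro!: eq_matI simp: mult add)
  qed
qed

end

theory Submission
  imports Defs "HOL-Algebra.QuotRing"
begin

text \<open>
  For the diagonal idempotents \<open>e\<^sub>i\<close> of \<open>T = T\<^sub>n(R)\<close> one has \<open>e\<^sub>j T e\<^sub>i = 0\<close> whenever \<open>i < j\<close>, so a prime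
  ideal of \<open>T\<close> contains all of them but exactly one, \<open>e\<^sub>i\<close> say.  It then contains \<open>1 - e\<^sub>i\<close>, hence the
  kernel of the surjective homomorphism \<open>A \<mapsto> a\<^sub>i\<^sub>i\<close>, and is the preimage of a prime ideal of \<open>R\<close> under
  it.  Writing \<open>P(a)\<close> for \<open>P\<^sub>a\<close>, the ideal \<open>P(A)\<close> therefore consists of the matrices \<open>B\<close> with
  \<open>b\<^sub>i\<^sub>i \<in> P(a\<^sub>i\<^sub>i)\<close> for all \<open>i\<close>, with no condition above the diagonal.  Applied to \<open>A = 0\<close> this forces
  \<open>J\<^sub>i\<^sub>j = R\<close> for \<open>i < j\<close>.
\<close>

section \<open>Prime ideals of noncommutative rings\<close>

context ring
begin

text \<open>Additive inverses come for free, since \<open>\<ominus> a\<close> is the product of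
  \<open>\<ominus> \<one>\<close> and \<open>a\<close>; this spares every later ideal check the
  subgroup axioms.\<close>

lemma idealI_closed:
  assumes "I \<subseteq> carrier R" "\<zero> \<in> I"
    and add: "\<And>a b. a \<in> I \<Longrightarrow> b \<in> I \<Longrightarrow> a \<oplus> b \<in> I"
    and l: "\<And>a x. a \<in> I \<Longrightarrow> x \<in> carrier R \<Longrightarrow> x \<otimes> a \<in> I"
    and r: "\<And>a x. a \<in> I \<Longrightarrow> x \<in> carrier R \<Longrightarrow> a \<otimes> x \<in> I"
  shows "ideal I R"
proof (rule idealI[OF ring_axioms _ l r])
  have "\<ominus> a \<in> I" if "a \<in> I" for a
    using l[OF that, of "\<ominus> \<one>"] that assms(1) by (auto simp: l_minus)
  then show "subgroup I (add_monoid R)"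
    using assms by (intro add.subgroupI) (auto simp: a_inv_def)
qed

text \<open>The elementwise form \<open>a R b \<subseteq> P\<close> of primeness passes through
  homomorphisms and matrix computations without any products of ideals, so the later proofs rely on
  it.\<close>

lemma nc_prime_ideal_iff:
  "nc_prime_ideal R P \<longleftrightarrow> ideal P R \<and> P \<noteq> carrier R \<and>
     (\<forall>a\<in>carrier R. \<forall>b\<in>carrier R. (\<forall>r\<in>carrier R. a \<otimes> r \<otimes> b \<in> P) \<longrightarrow> a \<in> P \<or> b \<in> P)"
proof (cases "ideal P R \<and> P \<noteq> carrier R")
  case True
  then interpret P: ideal P R by simp
  have "a \<in> P \<or> b \<in> P"
    if prime: "\<And>A B. ideal A R \<Longrightarrow> ideal B R \<Longrightarrow> A \<cdot> B \<subseteq> P \<Longrightarrow> A \<subseteq> P \<or> B \<subseteq> P"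
      and a: "a \<in> carrier R" and b: "b \<in> carrier R"
      and ab: "\<And>r. r \<in> carrier R \<Longrightarrow> a \<otimes> r \<otimes> b \<in> P" for a b
  proof -
    \<comment> \<open>\<open>A\<close> and \<open>B\<close> stand in for the principal ideals
      generated by \<open>a\<close> and \<open>b\<close>. Membership is a pointwise condition, so no
      sums of terms \<open>r \<otimes> a \<otimes> s\<close> have to be handled. The assumption on
      \<open>a\<close> and \<open>b\<close> gives \<open>a \<in> A\<close>, and the definition of
      \<open>A\<close> gives \<open>b \<in> B\<close>.\<close>
    define A where "A = {x \<in> carrier R. \<forall>r\<in>carrier R. x \<otimes> r \<otimes> b \<in> P}"
    define B where "B = {y \<in> carrier R. \<forall>x\<in>A. \<forall>r\<in>carrier R. x \<otimes> r \<otimes> y \<in> P}"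
    have AR: "x \<in> A \<Longrightarrow> x \<in> carrier R" for x by (simp add: A_def)
    have "ideal A R"
    proof (rule idealI_closed)
      fix x s assume x: "x \<in> A" and s: "s \<in> carrier R"
      have "s \<otimes> x \<otimes> r \<otimes> b = s \<otimes> (x \<otimes> r \<otimes> b)" if "r \<in> carrier R" for r
        using AR[OF x] s b that by (simp add: m_assoc)
      then show "s \<otimes> x \<in> A" using x s by (simp add: A_def P.I_l_closed)
      have "x \<otimes> s \<otimes> r \<otimes> b = x \<otimes> (s \<otimes> r) \<otimes> b" if "r \<in> carrier R" for r
        using AR[OF x] s b that by (simp add: m_assoc)
      then show "x \<otimes> s \<in> A" using x s by (simp add: A_def)
    qed (auto simp: A_def b l_distr)
    moreover have "ideal B R"
    proof (rule idealI_closed)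
      fix y s assume y: "y \<in> B" and s: "s \<in> carrier R"
      then have yR: "y \<in> carrier R" by (simp add: B_def)
      have "x \<otimes> r \<otimes> (s \<otimes> y) = x \<otimes> (r \<otimes> s) \<otimes> y" if "x \<in> A" "r \<in> carrier R" for x r
        using AR[OF that(1)] s yR that by (simp add: m_assoc)
      then show "s \<otimes> y \<in> B" using y s by (simp add: B_def)
      have "x \<otimes> r \<otimes> (y \<otimes> s) = x \<otimes> r \<otimes> y \<otimes> s" if "x \<in> A" "r \<in> carrier R" for x r
        using AR[OF that(1)] s yR that by (simp add: m_assoc)
      then show "y \<otimes> s \<in> B" using y s by (simp add: B_def P.I_r_closed)
    qed (auto simp: B_def AR r_distr)
    moreover have "A \<cdot> B \<subseteq> P"
    proof
      fix s assume "s \<in> A \<cdot> B"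
      then show "s \<in> P"
      proof (induction rule: ideal_prod.induct)
        case (prod x y)
        \<comment> \<open>The condition defining \<open>B\<close> is used with middle factor
          \<open>\<one>\<close>.\<close>
        then have "x \<otimes> \<one> \<otimes> y \<in> P" unfolding B_def by blast
        then show ?case using AR[OF prod(1)] by simp
      qed simp
    qed
    ultimately have "A \<subseteq> P \<or> B \<subseteq> P" by (rule prime)
    moreover have "a \<in> A" "b \<in> B" using a b ab by (auto simp: A_def B_def)
    ultimately show ?thesis by blast
  qed
  moreover have "A \<subseteq> P \<or> B \<subseteq> P"
    if prime: "\<And>a b. a \<in> carrier R \<Longrightarrow> b \<in> carrier R \<Longrightarrow>
        (\<And>r. r \<in> carrier R \<Longrightarrow> a \<otimes> r \<otimes> b \<in> P) \<Longrightarrow> a \<in> P \<or> b \<in> P"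
      and A: "ideal A R" and B: "ideal B R" and AB: "A \<cdot> B \<subseteq> P" for A B
  proof (rule ccontr)
    assume "\<not> (A \<subseteq> P \<or> B \<subseteq> P)"
    then obtain a b where a: "a \<in> A" "a \<notin> P" and b: "b \<in> B" "b \<notin> P" by blast
    have "a \<otimes> r \<otimes> b \<in> P" if "r \<in> carrier R" for r
      using AB ideal_prod.prod[OF ideal.I_r_closed[OF A a(1) that] b(1), of R] by blast
    then show False
      using prime[of a b] a b ideal.Icarr[OF A a(1)] ideal.Icarr[OF B b(1)] by blast
  qed
  ultimately show ?thesis
    using True unfolding nc_prime_ideal_def by (smt (verit, best))
qed (auto simp: nc_prime_ideal_def)

end

lemma (in ideal) one_notin:
  assumes "I \<noteq> carrier R"
  shows "\<one> \<notin> I"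
  using one_imp_carrier assms by blast

section \<open>Transfer of prime ideals along surjective ring homomorphisms\<close>

context ring_hom_ring
begin

text \<open>Surjectivity matters because the middle factor in the criterion for \<open>P\<close>
  runs over all of \<open>S\<close>: each such factor must be lifted to \<open>R\<close> before the
  assumption on \<open>a\<close> and \<open>b\<close> applies.\<close>

lemma nc_prime_ideal_vimage:
  assumes surj: "h ` carrier R = carrier S" and P: "nc_prime_ideal S P"
  shows "nc_prime_ideal R {r \<in> carrier R. h r \<in> P}"
proof -
  have idl: "ideal P S" and ne: "P \<noteq> carrier S"
    and prime: "\<And>a b. a \<in> carrier S \<Longrightarrow> b \<in> carrier S \<Longrightarrow>
        (\<And>r. r \<in> carrier S \<Longrightarrow> a \<otimes>\<^bsub>S\<^esub> r \<otimes>\<^bsub>S\<^esub> b \<in> P) \<Longrightarrow> a \<in> P \<or> b \<in> P"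
    using P unfolding S.nc_prime_ideal_iff by blast+
  have "{r \<in> carrier R. h r \<in> P} \<noteq> carrier R"
    using ideal.one_notin[OF idl ne] R.one_closed hom_one by force
  moreover have "h a \<in> P \<or> h b \<in> P"
    if a: "a \<in> carrier R" and b: "b \<in> carrier R"
      and ab: "\<forall>r\<in>carrier R. a \<otimes> r \<otimes> b \<in> {r \<in> carrier R. h r \<in> P}" for a b
  proof (rule prime)
    fix s assume "s \<in> carrier S"
    then obtain r where r: "r \<in> carrier R" "s = h r" using surj by blast
    then show "h a \<otimes>\<^bsub>S\<^esub> s \<otimes>\<^bsub>S\<^esub> h b \<in> P" using ab a b by force
  qed (use a b in auto)
  ultimately show ?thesis
    unfolding R.nc_prime_ideal_iff using ideal_vimage[OF idl] by blast
qed

text \<open>Containing the kernel makes \<open>Q\<close> a union of fibres of \<open>h\<close>, so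
  membership in \<open>Q\<close> can be tested after applying \<open>h\<close>, and ideal axioms,
  properness and primeness all move to the image.\<close>

lemma nc_prime_ideal_image:
  assumes surj: "h ` carrier R = carrier S" and Q: "nc_prime_ideal R Q"
    and ker: "\<And>r. r \<in> carrier R \<Longrightarrow> h r = \<zero>\<^bsub>S\<^esub> \<Longrightarrow> r \<in> Q"
  shows "nc_prime_ideal S (h ` Q)" and "Q = {r \<in> carrier R. h r \<in> h ` Q}"
proof -
  have idl: "ideal Q R" and ne: "Q \<noteq> carrier R"
    and prime: "\<And>a b. a \<in> carrier R \<Longrightarrow> b \<in> carrier R \<Longrightarrow>
        (\<And>r. r \<in> carrier R \<Longrightarrow> a \<otimes> r \<otimes> b \<in> Q) \<Longrightarrow> a \<in> Q \<or> b \<in> Q"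
    using Q unfolding R.nc_prime_ideal_iff by blast+
  interpret Q: ideal Q R by fact
  have mem: "r \<in> Q" if r: "r \<in> carrier R" and h: "h r \<in> h ` Q" for r
  proof -
    obtain q where q: "q \<in> Q" "h r = h q" using h by blast
    then have qR: "q \<in> carrier R" by (simp add: Q.Icarr)
    \<comment> \<open>Two elements with the same image differ by an element of the kernel.\<close>
    have "r \<ominus> q \<in> Q" using r q qR by (intro ker) (auto simp: R.minus_eq S.r_neg)
    then have "(r \<ominus> q) \<oplus> q \<in> Q" using q by simp
    then show ?thesis using r qR by (simp add: R.minus_eq R.add.m_assoc R.l_neg)
  qed
  then show Q_eq: "Q = {r \<in> carrier R. h r \<in> h ` Q}" using Q.Icarr by blast
  have "ideal (h ` Q) S"
  proof (rule S.idealI_closed)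
    show "h ` Q \<subseteq> carrier S" using Q.Icarr by auto
    show "\<zero>\<^bsub>S\<^esub> \<in> h ` Q" using Q.zero_closed by (metis hom_zero imageI)
  next
    fix a b assume "a \<in> h ` Q" "b \<in> h ` Q"
    then obtain q q' where "q \<in> Q" "q' \<in> Q" "a = h q" "b = h q'" by blast
    then show "a \<oplus>\<^bsub>S\<^esub> b \<in> h ` Q"
      using Q.Icarr by (intro image_eqI[of _ _ "q \<oplus> q'"]) auto
  next
    fix a x assume "a \<in> h ` Q" "x \<in> carrier S"
    then obtain q r where qr: "q \<in> Q" "r \<in> carrier R" "a = h q" "x = h r" using surj by blast
    show "x \<otimes>\<^bsub>S\<^esub> a \<in> h ` Q"
      using qr Q.Icarr by (intro image_eqI[of _ _ "r \<otimes> q"]) (auto simp: Q.I_l_closed)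
    show "a \<otimes>\<^bsub>S\<^esub> x \<in> h ` Q"
      using qr Q.Icarr by (intro image_eqI[of _ _ "q \<otimes> r"]) (auto simp: Q.I_r_closed)
  qed
  moreover have "h ` Q \<noteq> carrier S"
    using ideal.one_notin[OF idl ne] mem[of \<one>] by auto
  moreover have "a \<in> h ` Q \<or> b \<in> h ` Q"
    if a: "a \<in> carrier S" and b: "b \<in> carrier S" and ab: "\<forall>s\<in>carrier S. a \<otimes>\<^bsub>S\<^esub> s \<otimes>\<^bsub>S\<^esub> b \<in> h ` Q" for a b
  proof -
    obtain a' b' where a': "a' \<in> carrier R" "a = h a'" and b': "b' \<in> carrier R" "b = h b'"
      using a b surj by (metis imageE)
    have "a' \<otimes> r \<otimes> b' \<in> Q" if "r \<in> carrier R" for r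
    proof (rule mem)
      show "h (a' \<otimes> r \<otimes> b') \<in> h ` Q"
        using bspec[OF ab hom_closed[OF that]] that a' b' by simp
    qed (use that a' b' in simp)
    then have "a' \<in> Q \<or> b' \<in> Q" using prime a' b' by blast
    then show ?thesis using a' b' by blast
  qed
  ultimately show "nc_prime_ideal S (h ` Q)" unfolding S.nc_prime_ideal_iff by blast
qed

end

section \<open>Prime ideals of the upper triangular matrix ring\<close>

definition diag_mat_of :: "('a, 'b) ring_scheme \<Rightarrow> nat \<Rightarrow> (nat \<Rightarrow> 'a) \<Rightarrow> 'a mat" where
  "diag_mat_of R n f = mat n n (\<lambda>(i, j). if i = j then f i else \<zero>\<^bsub>R\<^esub>)"

text \<open>Indexing by a set rather than a single position covers \<open>e\<^sub>i\<close>, the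
  identity and \<open>1 - e\<^sub>i\<close> at once, the last being the case
  \<open>{..<n} - {i}\<close>.\<close>

definition diag_idem :: "('a, 'b) ring_scheme \<Rightarrow> nat \<Rightarrow> nat set \<Rightarrow> 'a mat" where
  "diag_idem R n S = diag_mat_of R n (\<lambda>i. if i \<in> S then \<one>\<^bsub>R\<^esub> else \<zero>\<^bsub>R\<^esub>)"

definition diag_vimage :: "('a, 'b) ring_scheme \<Rightarrow> nat \<Rightarrow> nat \<Rightarrow> 'a set \<Rightarrow> 'a mat set" where
  "diag_vimage R n i P = {A \<in> carrier (upper_tri_ring R n). A $$ (i, i) \<in> P}"

context ring
begin

section \<open>Entries, diagonal idempotents and diagonal homomorphisms\<close>

abbreviation "T n \<equiv> upper_tri_ring R n"

lemma ut_entry [simp]: "A \<in> carrier (T n) \<Longrightarrow> i < n \<Longrightarrow> j < n \<Longrightarrow> A $$ (i, j) \<in> carrier R"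
  and ut_lower: "A \<in> carrier (T n) \<Longrightarrow> i < n \<Longrightarrow> j < i \<Longrightarrow> A $$ (i, j) = \<zero>"
  and ut_dim: "A \<in> carrier (T n) \<Longrightarrow> dim_row A = n" "A \<in> carrier (T n) \<Longrightarrow> dim_col A = n"
  by (auto simp: upper_tri_ring_def upper_tri_carrier_def)

lemma ut_eqI:
  assumes "A \<in> carrier (T n)" "B \<in> carrier (T n)"
    and "\<And>i j. i \<le> j \<Longrightarrow> j < n \<Longrightarrow> A $$ (i, j) = B $$ (i, j)"
  shows "A = B"
proof (rule eq_matI)
  fix i j assume "i < dim_row B" "j < dim_col B"
  then show "A $$ (i, j) = B $$ (i, j)"
    using assms by (cases "i \<le> j") (auto simp: ut_dim ut_lower)
qed (use assms in \<open>auto simp: ut_dim\<close>)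

lemma ut_matI:
  assumes "\<And>i j. i < n \<Longrightarrow> j < n \<Longrightarrow> f (i, j) \<in> carrier R"
    and "\<And>i j. i < n \<Longrightarrow> j < i \<Longrightarrow> f (i, j) = \<zero>"
  shows "mat n n f \<in> carrier (T n)"
proof -
  have "mat n n f $$ (i, j) \<in> carrier R" if "i < n" "j < n" for i j
    using assms(1)[OF that] that by simp
  moreover have "mat n n f $$ (i, j) = \<zero>" if "i < n" "j < i" for i j
    using assms(2)[OF that] that by simp
  ultimately have "mat n n f \<in> upper_tri_carrier R n"
    using mat_carrier[of n n f] unfolding upper_tri_carrier_def by blast
  then show ?thesis by (simp add: upper_tri_ring_def)
qed

lemma ut_add_index: "i < n \<Longrightarrow> j < n \<Longrightarrow> (A \<oplus>\<^bsub>T n\<^esub> B) $$ (i, j) = A $$ (i, j) \<oplus> B $$ (i, j)"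
  and ut_mult_index: "i < n \<Longrightarrow> j < n \<Longrightarrow>
    (A \<otimes>\<^bsub>T n\<^esub> B) $$ (i, j) = (\<Oplus>k\<in>{..<n}. A $$ (i, k) \<otimes> B $$ (k, j))"
  and ut_zero_index: "i < n \<Longrightarrow> j < n \<Longrightarrow> \<zero>\<^bsub>T n\<^esub> $$ (i, j) = \<zero>"
  and ut_one_index: "i < n \<Longrightarrow> j < n \<Longrightarrow> \<one>\<^bsub>T n\<^esub> $$ (i, j) = (if i = j then \<one> else \<zero>)"
  by (simp_all add: upper_tri_ring_def)

lemma finsum_lessThan_single:
  fixes i n :: nat
  assumes "i < n" "f i \<in> carrier R" "\<And>k. k < n \<Longrightarrow> k \<noteq> i \<Longrightarrow> f k = \<zero>"
  shows "(\<Oplus>k\<in>{..<n}. f k) = f i"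
proof -
  have f: "f k \<in> carrier R" if "k < n" for k
    using assms that by (cases "k = i") auto
  have "(\<Oplus>k\<in>{..<n}. f k) = (\<Oplus>k\<in>{..<n}. if i = k then f k else \<zero>)"
    using assms by (intro finsum_cong') auto
  also have "\<dots> = f i" using assms f by (intro finsum_singleton) auto
  finally show ?thesis .
qed

text \<open>For \<open>k \<noteq> i\<close> one of the factors \<open>A $$ (i, k)\<close> and
  \<open>B $$ (k, i)\<close> lies below the diagonal. Hence taking a diagonal entry is
  multiplicative.\<close>

lemma ut_mult_diag:
  assumes "A \<in> carrier (T n)" "B \<in> carrier (T n)" "i < n"
  shows "(A \<otimes>\<^bsub>T n\<^esub> B) $$ (i, i) = A $$ (i, i) \<otimes> B $$ (i, i)"
proof -
  have "A $$ (i, k) \<otimes> B $$ (k, i) = \<zero>" if "k < n" "k \<noteq> i" for k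
    using that assms by (cases "k < i") (auto simp: ut_lower)
  then show ?thesis
    using assms by (simp add: ut_mult_index finsum_lessThan_single)
qed

lemma diag_mat_of_closed:
  assumes "\<And>i. i < n \<Longrightarrow> f i \<in> carrier R"
  shows "diag_mat_of R n f \<in> carrier (T n)"
  unfolding diag_mat_of_def using assms by (intro ut_matI) auto

lemma diag_mat_of_index:
  "i < n \<Longrightarrow> j < n \<Longrightarrow> diag_mat_of R n f $$ (i, j) = (if i = j then f i else \<zero>)"
  by (simp add: diag_mat_of_def)

lemma diag_idem_closed [simp]: "diag_idem R n S \<in> carrier (T n)"
  unfolding diag_idem_def by (rule diag_mat_of_closed) simp

lemma diag_idem_index:
  "i < n \<Longrightarrow> j < n \<Longrightarrow> diag_idem R n S $$ (i, j) = (if i = j \<and> i \<in> S then \<one> else \<zero>)"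
  by (simp add: diag_idem_def diag_mat_of_index)

lemma diag_idem_mult_index:
  assumes "A \<in> carrier (T n)" "i < n" "j < n"
  shows "(diag_idem R n S \<otimes>\<^bsub>T n\<^esub> A) $$ (i, j) = (if i \<in> S then A $$ (i, j) else \<zero>)"
    and "(A \<otimes>\<^bsub>T n\<^esub> diag_idem R n S) $$ (i, j) = (if j \<in> S then A $$ (i, j) else \<zero>)"
  using assms
  by (simp_all add: ut_mult_index diag_idem_index finsum_lessThan_single[of i]
      finsum_lessThan_single[of j])

lemma diag_entry_hom:
  assumes "i < n"
  shows "ring_hom_ring (T n) R (\<lambda>A. A $$ (i, i))"
  using assms upper_tri_ring_is_ring[OF ring_axioms] ring_axioms
  by (intro ring_hom_ringI) (auto simp: ut_mult_diag ut_add_index ut_one_index)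

lemma diag_entry_surj:
  assumes "i < n"
  shows "(\<lambda>A. A $$ (i, i)) ` carrier (T n) = carrier R"
proof (intro equalityI subsetI)
  fix r assume "r \<in> carrier R"
  then show "r \<in> (\<lambda>A. A $$ (i, i)) ` carrier (T n)"
    using assms
    by (intro image_eqI[of _ _ "diag_mat_of R n (\<lambda>_. r)"]) (auto simp: diag_mat_of_index diag_mat_of_closed)
qed (use assms in auto)

section \<open>Classification of the prime ideals of \<open>T n\<close>\<close>

lemma nc_prime_ideal_diag_vimage:
  "i < n \<Longrightarrow> nc_prime_ideal R P \<Longrightarrow> nc_prime_ideal (T n) (diag_vimage R n i P)"
  unfolding diag_vimage_def
  by (intro ring_hom_ring.nc_prime_ideal_vimage[OF diag_entry_hom diag_entry_surj])

lemma nc_prime_ideal_ut: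
  assumes Q: "nc_prime_ideal (T n) Q"
  obtains i P where "i < n" "nc_prime_ideal R P" "Q = diag_vimage R n i P"
proof -
  interpret T: ring "T n" by (rule upper_tri_ring_is_ring[OF ring_axioms])
  have idl: "ideal Q (T n)" and ne: "Q \<noteq> carrier (T n)"
    and prime: "\<And>A B. A \<in> carrier (T n) \<Longrightarrow> B \<in> carrier (T n) \<Longrightarrow>
        (\<And>C. C \<in> carrier (T n) \<Longrightarrow> A \<otimes>\<^bsub>T n\<^esub> C \<otimes>\<^bsub>T n\<^esub> B \<in> Q) \<Longrightarrow> A \<in> Q \<or> B \<in> Q"
    using Q unfolding T.nc_prime_ideal_iff by blast+
  interpret Q: ideal Q "T n" by fact
  let ?e = "diag_idem R n"
  \<comment> \<open>The product keeps only the entry of \<open>C\<close> at \<open>(j, i)\<close>,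
    which is below the diagonal and so vanishes. Therefore at most one \<open>?e {i}\<close> lies
    outside \<open>Q\<close>.\<close>
  have pair: "?e {j} \<in> Q \<or> ?e {i} \<in> Q" if "i < j" "j < n" for i j
  proof (rule prime)
    fix C assume C: "C \<in> carrier (T n)"
    have "?e {j} \<otimes>\<^bsub>T n\<^esub> C \<otimes>\<^bsub>T n\<^esub> ?e {i} = \<zero>\<^bsub>T n\<^esub>"
      using C that by (intro ut_eqI) (auto simp: diag_idem_mult_index ut_zero_index ut_lower)
    then show "?e {j} \<otimes>\<^bsub>T n\<^esub> C \<otimes>\<^bsub>T n\<^esub> ?e {i} \<in> Q" by simp
  qed simp_all
  \<comment> \<open>Used twice: on \<open>{..<n}\<close> to find an idempotent outside
    \<open>Q\<close>, and on the complement of its index.\<close>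
  have idem: "?e S \<in> Q" if "finite S" "\<And>k. k \<in> S \<Longrightarrow> ?e {k} \<in> Q" for S
    using that
  proof (induction S rule: finite_induct)
    case empty
    have "?e {} = \<zero>\<^bsub>T n\<^esub>" by (intro ut_eqI) (auto simp: diag_idem_index ut_zero_index)
    then show ?case by simp
  next
    case (insert k S)
    have "?e (insert k S) = ?e {k} \<oplus>\<^bsub>T n\<^esub> ?e S"
      using insert.hyps by (intro ut_eqI) (auto simp: diag_idem_index ut_add_index)
    then show ?case using insert by simp
  qed
  have "?e {..<n} = \<one>\<^bsub>T n\<^esub>"
    by (intro ut_eqI) (auto simp: diag_idem_index ut_one_index)
  then have "?e {..<n} \<notin> Q" using Q.one_notin[OF ne] by simp
  then obtain i where i: "i < n" "?e {i} \<notin> Q" using idem[of "{..<n}"] by auto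
  have "?e {k} \<in> Q" if "k < n" "k \<noteq> i" for k
    using pair[of i k] pair[of k i] that i by (cases "k < i") auto
  then have f: "?e ({..<n} - {i}) \<in> Q" by (intro idem[of "{..<n} - {i}"]) auto
  let ?f = "?e ({..<n} - {i})"
  have ker: "A \<in> Q" if A: "A \<in> carrier (T n)" and "A $$ (i, i) = \<zero>" for A
  proof -
    \<comment> \<open>The first summand holds the rows of \<open>A\<close> other than row
      \<open>i\<close>, the second holds row \<open>i\<close> without its diagonal entry, which is
      zero by assumption. Each summand has the factor \<open>?f\<close>, an element of
      \<open>Q\<close>.\<close>
    have "A = ?f \<otimes>\<^bsub>T n\<^esub> A \<oplus>\<^bsub>T n\<^esub> ?e {i} \<otimes>\<^bsub>T n\<^esub> (A \<otimes>\<^bsub>T n\<^esub> ?f)"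
      using that by (intro ut_eqI) (auto simp: diag_idem_mult_index ut_add_index)
    also have "\<dots> \<in> Q" using A f by (intro Q.a_closed Q.I_l_closed Q.I_r_closed) auto
    finally show ?thesis .
  qed
  note im = ring_hom_ring.nc_prime_ideal_image[OF diag_entry_hom[OF i(1)] diag_entry_surj[OF i(1)] Q ker]
  show thesis
    using that[OF i(1) im(1)] im(2) unfolding diag_vimage_def by blast
qed

section \<open>Minimal primes and their intersections\<close>

lemma diag_vimage_subset_imp:
  assumes "i < n" "j < n" and P: "nc_prime_ideal R P" and P': "nc_prime_ideal R P'"
    and sub: "diag_vimage R n j P' \<subseteq> diag_vimage R n i P"
  shows "j = i" and "P' \<subseteq> P"
proof -
  have idl: "ideal P R" and ne: "P \<noteq> carrier R" and idl': "ideal P' R"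
    using P P' by (auto simp: nc_prime_ideal_iff)
  interpret P': ideal P' R by fact
  show "j = i"
  proof (rule ccontr)
    assume "j \<noteq> i"
    \<comment> \<open>The idempotent at \<open>i\<close> separates the two preimages: its entry at
      \<open>j\<close> is \<open>\<zero>\<close>, its entry at \<open>i\<close> is
      \<open>\<one>\<close>.\<close>
    then have "diag_idem R n {i} \<in> diag_vimage R n j P'"
      using assms \<open>j \<noteq> i\<close> by (simp add: diag_vimage_def diag_idem_index)
    then have "\<one> \<in> P"
      using sub \<open>i < n\<close> by (auto simp: diag_vimage_def diag_idem_index dest!: subsetD)
    then show False using ideal.one_notin[OF idl ne] by simp
  qed
  show "P' \<subseteq> P"
  proof
    fix p assume p: "p \<in> P'"
    then obtain A where "A \<in> carrier (T n)" "A $$ (i, i) = p"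
      using diag_entry_surj[OF \<open>i < n\<close>] P'.Icarr by (metis imageE)
    then show "p \<in> P"
      using sub p \<open>j = i\<close> by (auto simp: diag_vimage_def)
  qed
qed

text \<open>Ordered by inclusion, the primes of \<open>T n\<close> form \<open>n\<close> mutually
  incomparable copies of the primes of \<open>R\<close>, so minimality can be decided within each
  copy.\<close>

lemma minimal_prime_ideal_ut_iff:
  "minimal_prime_ideal (T n) Q \<longleftrightarrow> (\<exists>i<n. \<exists>P. minimal_prime_ideal R P \<and> Q = diag_vimage R n i P)"
proof
  assume Q: "minimal_prime_ideal (T n) Q"
  then have min: "\<And>Q'. nc_prime_ideal (T n) Q' \<Longrightarrow> Q' \<subseteq> Q \<Longrightarrow> Q' = Q"
    by (auto simp: minimal_prime_ideal_def)
  obtain i P where i: "i < n" and P: "nc_prime_ideal R P" and Q_eq: "Q = diag_vimage R n i P"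
    using Q nc_prime_ideal_ut unfolding minimal_prime_ideal_def by metis
  have "P' = P" if P': "nc_prime_ideal R P'" "P' \<subseteq> P" for P'
  proof -
    have "diag_vimage R n i P' \<subseteq> Q" using P' by (auto simp: Q_eq diag_vimage_def)
    then have "diag_vimage R n i P' = Q"
      using min nc_prime_ideal_diag_vimage[OF i P'(1)] by blast
    then show ?thesis
      using diag_vimage_subset_imp(2)[OF i i P'(1) P] P'(2) by (simp add: Q_eq)
  qed
  then show "\<exists>i<n. \<exists>P. minimal_prime_ideal R P \<and> Q = diag_vimage R n i P"
    using i P Q_eq by (auto simp: minimal_prime_ideal_def)
next
  assume "\<exists>i<n. \<exists>P. minimal_prime_ideal R P \<and> Q = diag_vimage R n i P"
  then obtain i P where i: "i < n" and P: "minimal_prime_ideal R P" and Q_eq: "Q = diag_vimage R n i P"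
    by blast
  then have pP: "nc_prime_ideal R P" and min: "\<And>P'. nc_prime_ideal R P' \<Longrightarrow> P' \<subseteq> P \<Longrightarrow> P' = P"
    by (auto simp: minimal_prime_ideal_def)
  have "Q' = Q" if Q': "nc_prime_ideal (T n) Q'" "Q' \<subseteq> Q" for Q'
  proof -
    obtain j P' where j: "j < n" and P': "nc_prime_ideal R P'" and Q'_eq: "Q' = diag_vimage R n j P'"
      using nc_prime_ideal_ut[OF Q'(1)] .
    show ?thesis
      using diag_vimage_subset_imp[OF i j pP P'] min[OF P'] Q'(2) by (simp add: Q_eq Q'_eq)
  qed
  then show "minimal_prime_ideal (T n) Q"
    using nc_prime_ideal_diag_vimage[OF i pP] by (simp add: minimal_prime_ideal_def Q_eq)
qed

text \<open>The minimal primes at index \<open>i\<close> that contain \<open>A\<close> correspond to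
  the minimal primes of \<open>R\<close> containing \<open>A $$ (i, i)\<close>, and they restrict
  only the entry \<open>(i, i)\<close> of \<open>B\<close>. If there are none,
  \<open>min_prime_meet\<close> is the carrier and that entry is free, on both sides.\<close>

lemma min_prime_meet_ut_iff:
  assumes A: "A \<in> carrier (T n)"
  shows "B \<in> min_prime_meet (T n) A \<longleftrightarrow>
    B \<in> carrier (T n) \<and> (\<forall>i<n. B $$ (i, i) \<in> min_prime_meet R (A $$ (i, i)))"
  using A unfolding min_prime_meet_def minimal_prime_ideal_ut_iff
  by (auto simp: diag_vimage_def)

text \<open>Takes care of the zero diagonal entries of the test matrices in the theorem.\<close>

lemma zero_mem_min_prime_meet: "\<zero> \<in> min_prime_meet R a"
proof -
  have "\<zero> \<in> P" if "minimal_prime_ideal R P" for P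
    using that additive_subgroup.zero_closed[of P R] ideal.axioms(1)[of P R]
    by (simp add: minimal_prime_ideal_def nc_prime_ideal_def)
  then show ?thesis by (simp add: min_prime_meet_def)
qed

end

section \<open>Ideals of \<open>T n\<close> that are z-circ ideals\<close>

theorem theorem4p5:
  fixes R :: "('a, 'b) ring_scheme" (structure)
    and n :: nat
    and I :: "'a mat set"
    and J :: "nat \<Rightarrow> nat \<Rightarrow> 'a set"
  assumes "ring R"
    and "\<one> \<noteq> \<zero>"
    and "n \<ge> 1"
    and "ideal I (upper_tri_ring R n)"
    and "\<And>i j. i \<le> j \<Longrightarrow> j < n \<Longrightarrow> ideal (J i j) R"
    and "I = upper_tri_entries R n J"
  shows "z_circ_ideal (upper_tri_ring R n) I \<longleftrightarrow>
    (\<forall>i<n. z_circ_ideal R (J i i)) \<and>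
    (\<forall>i<n. \<forall>j<n. i < j \<longrightarrow> J i j = carrier R)"
proof -
  interpret ring R by fact
  interpret T: ring "T n" by (rule upper_tri_ring_is_ring[OF ring_axioms])
  note idl = assms(5)
  have J0: "\<zero> \<in> J i j" if "i \<le> j" "j < n" for i j
    using idl[OF that] by (simp add: ideal.axioms(1) additive_subgroup.zero_closed)
  have mem_I: "A \<in> I \<longleftrightarrow> A \<in> carrier (T n) \<and> (\<forall>i j. i \<le> j \<longrightarrow> j < n \<longrightarrow> A $$ (i, j) \<in> J i j)" for A
    by (auto simp: assms(6) upper_tri_entries_def upper_tri_ring_def)
  have meet0: "\<zero> \<in> min_prime_meet R a" for a
    by (rule zero_mem_min_prime_meet)
  show ?thesis
  proof (intro iffI conjI allI impI)
    assume z: "z_circ_ideal (T n) I"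
    then have meet_I: "B \<in> I" if "A \<in> I" "B \<in> min_prime_meet (T n) A" for A B
      using that by (auto simp: z_circ_ideal_def)
    fix i assume i: "i < n"
    show "z_circ_ideal R (J i i)"
      unfolding z_circ_ideal_def
    proof (intro conjI ballI subsetI)
      show "ideal (J i i) R" using idl i by simp
      fix a b assume a: "a \<in> J i i" and b: "b \<in> min_prime_meet R a"
      have aR: "a \<in> carrier R" using ideal.Icarr[OF idl a] i by simp
      have bR: "b \<in> carrier R" using b by (simp add: min_prime_meet_def)
      \<comment> \<open>The problem in \<open>R\<close> is placed at position \<open>(i, i)\<close>.
        All other entries are zero, which keeps \<open>?d a\<close> in \<open>I\<close> and puts
        \<open>?d b\<close> in the meet for \<open>?d a\<close>.\<close>
      let ?d = "\<lambda>r. diag_mat_of R n (\<lambda>k. if k = i then r else \<zero>)"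
      have d: "?d r \<in> carrier (T n)" if "r \<in> carrier R" for r
        using that by (intro diag_mat_of_closed) simp
      have "?d a \<in> I" using d[OF aR] a J0 by (auto simp: mem_I diag_mat_of_index)
      moreover have "?d b \<in> min_prime_meet (T n) (?d a)"
        using d[OF aR] d[OF bR] b meet0 by (auto simp: min_prime_meet_ut_iff diag_mat_of_index)
      ultimately have "?d b \<in> I" by (rule meet_I)
      then have "?d b $$ (i, i) \<in> J i i" using i by (simp add: mem_I)
      then show "b \<in> J i i" using i by (simp add: diag_mat_of_index)
    qed
    fix j assume j: "j < n" and ij: "i < j"
    have "r \<in> J i j" if r: "r \<in> carrier R" for r
    proof -
      \<comment> \<open>A multiple of a matrix unit strictly above the diagonal has zero diagonal,
        so it lies in every minimal prime of \<open>T n\<close> and cannot be told apart from zero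
        by the meet.\<close>
      let ?E = "mat n n (\<lambda>(k, l). if k = i \<and> l = j then r else \<zero>)"
      have E: "?E \<in> carrier (T n)" using r ij by (intro ut_matI) auto
      have "\<zero>\<^bsub>T n\<^esub> \<in> I" using J0 by (auto simp: mem_I ut_zero_index)
      moreover have "?E \<in> min_prime_meet (T n) \<zero>\<^bsub>T n\<^esub>"
        using E ij meet0 by (auto simp: min_prime_meet_ut_iff)
      ultimately have "?E \<in> I" by (rule meet_I)
      then have "?E $$ (i, j) \<in> J i j" using ij j unfolding mem_I by (meson less_imp_le)
      then show ?thesis using i j by simp
    qed
    then show "J i j = carrier R" using ideal.Icarr[OF idl[OF less_imp_le[OF ij] j]] by blast
  next
    assume R: "(\<forall>i<n. z_circ_ideal R (J i i)) \<and> (\<forall>i<n. \<forall>j<n. i < j \<longrightarrow> J i j = carrier R)"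
    show "z_circ_ideal (T n) I"
      unfolding z_circ_ideal_def
    proof (intro conjI ballI subsetI)
      fix A B assume A: "A \<in> I" and B: "B \<in> min_prime_meet (T n) A"
      have AT: "A \<in> carrier (T n)" and AJ: "\<And>i. i < n \<Longrightarrow> A $$ (i, i) \<in> J i i"
        using A by (auto simp: mem_I)
      have BT: "B \<in> carrier (T n)"
        and BP: "\<And>i. i < n \<Longrightarrow> B $$ (i, i) \<in> min_prime_meet R (A $$ (i, i))"
        using B by (auto simp: min_prime_meet_ut_iff[OF AT])
      \<comment> \<open>On the diagonal the hypothesis on \<open>J i i\<close> applies to
        \<open>A $$ (i, i)\<close>; above it \<open>J i j\<close> is the whole ring.\<close>
      have "B $$ (i, j) \<in> J i j" if ij: "i \<le> j" "j < n" for i j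
      proof (cases "i = j")
        case True
        then show ?thesis using R AJ BP ij unfolding z_circ_ideal_def by blast
      next
        case False
        then show ?thesis using R ij BT by simp
      qed
      then show "B \<in> I" using BT by (simp add: mem_I)
    qed (rule assms(4))
  qed
qed

end
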